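(* Let $\{\mathcal{T}(t)\}_{t\ge 0}$ be the symmetric telegraph process with speed $c>0$ and rate $\lambda>0$, and let $t>0$. For every integer $k\ge 0$ and $0<\beta<ct$, $$P\Bigl\{ \max_{0\le s\le t} \mathcal{T}(s) > \beta,\ \mathcal{T}(t)<\beta \,\Big|\, N(t) = 2k+1,\ V(0)=c\Bigr\} = P\Bigl\{ \max_{0\le s\le t} \mathcal{T}(s) > \beta,\ \mathcal{T}(t)>\beta \,\Big|\, N(t) = 2k+1,\ V(0)=c\Bigr\}$$ $$= P\bigl\{ \mathcal{T}(t)>\beta \,\big|\, N(t) = 2k+1,\ V(0)=c\bigr\} .$$
   Context: Let $c>0$, $\lambda>0$. Let $V(0)$ be a random variable with $P\{V(0)=c\}=P\{V(0)=-c\}=\tfrac12$ and let $\{N(t)\}_{t\ge0}$ be a homogeneous Poisson process with rate $\lambda$, independent of $V(0)$. The symmetric telegraph process is $\mathcal{T}(t)=\int_0^t V(0)(-1)^{N(s)}\,ds$, $t\ge 0$ (so $\mathcal{T}(0)=0$). *)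

theory Defs
  imports "HOL-Probability.Probability"
begin

text \<open>
  The path properties of the counting process are required for every sample point, not merely
  almost surely: \<open>M\<close> need not be complete, so changing paths on a null set could make the events
  below non-measurable. That almost all jumps have size one follows from the Poisson increments.
  Time is \<open>[0,\<infinity>)\<close>; the values of \<open>N\<close> at negative times are irrelevant. Subtraction of naturals
  in the increments does not truncate, because paths are nondecreasing.
\<close>

locale poisson_process = prob_space M for M :: "'a measure" +
  fixes N :: "real \<Rightarrow> 'a \<Rightarrow> nat" and rate :: real
  assumes rate_pos: "rate > 0"
    and random_variable_N: "\<And>t. t \<ge> 0 \<Longrightarrow> random_variable (count_space UNIV) (N t)"
    and N_0: "\<And>\<omega>. \<omega> \<in> space M \<Longrightarrow> N 0 \<omega> = 0"
    and N_mono: "\<And>\<omega>. \<omega> \<in> space M \<Longrightarrow> mono_on {0..} (\<lambda>t. N t \<omega>)"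
    and N_right_continuous:
      "\<And>\<omega> t. \<omega> \<in> space M \<Longrightarrow> t \<ge> 0 \<Longrightarrow> continuous (at_right t) (\<lambda>s. N s \<omega>)"
    and independent_increments:
      "\<And>(ts :: nat \<Rightarrow> real) n. 0 \<le> ts 0 \<Longrightarrow> (\<And>i. i < n \<Longrightarrow> ts i < ts (Suc i)) \<Longrightarrow>
         indep_vars (\<lambda>_. count_space UNIV) (\<lambda>i \<omega>. N (ts (Suc i)) \<omega> - N (ts i) \<omega>) {..<n}"
    and poisson_increments:
      "\<And>s t. 0 \<le> s \<Longrightarrow> s < t \<Longrightarrow>
         distr M (count_space UNIV) (\<lambda>\<omega>. N t \<omega> - N s \<omega>) = measure_pmf (poisson_pmf (rate * (t - s)))"

text \<open>
  The initial velocity is independent of the whole process \<open>N\<close>, viewed as a random element of the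
  product space over \<open>[0,\<infinity>)\<close>. Independence is stated for the generated \<open>\<sigma>\<close>-algebras, since
  \<open>indep_var\<close> needs both random elements to have the same type.
\<close>

locale symmetric_telegraph = poisson_process M N rate
  for M :: "'a measure" and N :: "real \<Rightarrow> 'a \<Rightarrow> nat" and rate :: real +
  fixes V0 :: "'a \<Rightarrow> real" and c :: real
  assumes speed_pos: "c > 0"
    and random_variable_V0: "random_variable borel V0"
    and V0_pos: "\<P>(\<omega> in M. V0 \<omega> = c) = 1 / 2"
    and V0_neg: "\<P>(\<omega> in M. V0 \<omega> = - c) = 1 / 2"
    and V0_indep_N:
      "indep_set (sets (vimage_algebra (space M) V0 borel))
         (sets (vimage_algebra (space M) (\<lambda>\<omega>. \<lambda>t\<in>{0..}. N t \<omega>) (Pi\<^sub>M {0..} (\<lambda>_. count_space UNIV))))"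

definition telegraph :: "('a \<Rightarrow> real) \<Rightarrow> (real \<Rightarrow> 'a \<Rightarrow> nat) \<Rightarrow> real \<Rightarrow> 'a \<Rightarrow> real" where
  "telegraph V0 N t \<omega> = (LBINT s:{0..t}. V0 \<omega> * (- 1) ^ N s \<omega>)"

definition running_max :: "(real \<Rightarrow> 'a \<Rightarrow> real) \<Rightarrow> real \<Rightarrow> 'a \<Rightarrow> real" where
  "running_max X t \<omega> = (GREATEST m. m \<in> (\<lambda>s. X s \<omega>) ` {0..t})"

text \<open>The maximum exists for continuous paths, such as those of the telegraph process.\<close>

lemma running_max_attained:
  assumes "continuous_on {0..t} (\<lambda>s. X s \<omega>)" "t \<ge> 0"
  shows "\<exists>s\<in>{0..t}. running_max X t \<omega> = X s \<omega> \<and> (\<forall>u\<in>{0..t}. X u \<omega> \<le> X s \<omega>)"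
proof -
  obtain s where s: "s \<in> {0..t}" "\<forall>u\<in>{0..t}. X u \<omega> \<le> X s \<omega>"
    using continuous_attains_sup[OF compact_Icc _ assms(1)] assms(2) by auto
  have "running_max X t \<omega> = X s \<omega>"
    unfolding running_max_def using s by (intro Greatest_equality) auto
  with s show ?thesis by blast
qed

end

theory Submission
  imports Defs
begin

text \<open>
  Cut \<open>[0,t]\<close> into \<open>n\<close> cells; the increments of \<open>N\<close> over the cells are i.i.d., so their joint law
  is invariant under rearrangement. Given \<open>V(0) = c\<close> and \<open>N(t)\<close> odd, reverse the order of the
  increments after the first time the discretised path reaches a level. At that time the path is
  moving upwards, so an odd number of jumps remains, and time reversal of the remaining piece
  negates its displacement. This is a reflection principle: hitting the level and ending below it is
  exactly as likely as ending above it. On \<open>N(t) = K\<close> the discretisation error is at most a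
  constant times \<open>1/n\<close>, uniformly in the path, so the identity survives \<open>n \<rightarrow> \<infinity>\<close> as soon as
  the law of \<open>T(t)\<close> has no atoms. The latter also follows from exchangeability, applied to cyclic
  rotations of the increments.
\<close>

section \<open>Displacement and reflection of increment lists\<close>

text \<open>For a list of increments of the counting path over the cells of a grid, \<open>disp\<close> is twice the
  trapezoid sum of \<open>(- 1) ^ N\<close>, in units of the mesh. The trapezoid rule makes it exactly
  equivariant under reversal, and the factor 2 keeps it integer-valued.\<close>

fun disp :: "nat list \<Rightarrow> int" where
  "disp [] = 0"
| "disp (x # xs) = 1 + (- 1) ^ x + (- 1) ^ x * disp xs"

lemma disp_append: "disp (xs @ ys) = disp xs + (- 1) ^ sum_list xs * disp ys"
  by (induction xs) (simp_all add: algebra_simps power_add)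

text \<open>Backwards in time, the sign at each grid point is the forward sign times the final one,
  and the trapezoid weights are symmetric.\<close>

lemma disp_rev: "disp (rev xs) = (- 1) ^ sum_list xs * disp xs"
proof (induction xs)
  case (Cons x xs)
  have "(- 1 :: int) ^ x * (- 1) ^ x = 1"
    by (simp flip: power_add power_mult_distrib)
  then show ?case using Cons
    by (simp add: disp_append sum_list_rev algebra_simps power_add)
qed simp

text \<open>Partial displacements move on the even integers by steps of 0, 2 or -2, so an even level
  cannot be jumped over.\<close>

lemma even_disp: "even (disp xs)"
  by (induction xs) auto

lemma disp_take_Suc:
  assumes "m < length d"
  shows "disp (take (Suc m) d) = disp (take m d) + (- 1) ^ sum_list (take m d) * (1 + (- 1) ^ (d ! m))"
  using assms by (simp add: take_Suc_conv_app_nth disp_append)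

text \<open>With an odd total the two pieces carry opposite signs, so the two contributions of the
  initial piece add up. With an even total they would cancel, and rotation could only change the
  sign of the displacement.\<close>

lemma disp_rotate:
  assumes "odd (sum_list d)" "i < length d"
  shows "disp (rotate i d) = (- 1) ^ sum_list (take i d) * (disp d - 2 * disp (take i d))"
proof -
  define a b where "a = take i d" and "b = drop i d"
  have d: "d = a @ b" and rot: "rotate i d = b @ a"
    using assms by (simp_all add: a_def b_def rotate_drop_take)
  have "odd (sum_list a + sum_list b)" using assms(1) d by simp
  then have "(- 1 :: int) ^ sum_list b = - ((- 1) ^ sum_list a)"
    by (cases "even (sum_list a)") auto
  moreover have "(- 1 :: int) ^ sum_list a * (- 1) ^ sum_list a = 1"
    by (simp flip: power_add power_mult_distrib)
  ultimately show ?thesis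
    unfolding rot a_def[symmetric] by (simp add: d disp_append algebra_simps)
qed

section \<open>Reflection at the first hit of a level\<close>

definition hits :: "int \<Rightarrow> nat list \<Rightarrow> bool" where
  "hits B d \<longleftrightarrow> (\<exists>m\<le>length d. B \<le> disp (take m d))"

text \<open>Prefixes longer than \<open>d\<close> equal \<open>d\<close>, so an unbounded
  \<open>m\<close> gives the same least index. Without a hit the value is unspecified, which is why
  the lemmas below assume \<open>hits B d\<close>.\<close>

definition first_hit :: "int \<Rightarrow> nat list \<Rightarrow> nat" where
  "first_hit B d = (LEAST m. B \<le> disp (take m d))"

text \<open>Flipping the velocities after the hit would change the parity of the number of jumps.
  For an odd total, reversing the remainder moves the endpoint in the same way and only permutes the
  increments.\<close>

definition reflect :: "int \<Rightarrow> nat list \<Rightarrow> nat list" where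
  "reflect B d = take (first_hit B d) d @ rev (drop (first_hit B d) d)"

lemma
  assumes "hits B d"
  shows first_hit_le_length: "first_hit B d \<le> length d"
    and first_hit_disp_ge: "B \<le> disp (take (first_hit B d) d)"
    and before_first_hit: "m < first_hit B d \<Longrightarrow> disp (take m d) < B"
proof -
  obtain m0 where m0: "m0 \<le> length d" "B \<le> disp (take m0 d)"
    using assms by (auto simp: hits_def)
  show "B \<le> disp (take (first_hit B d) d)"
    unfolding first_hit_def by (rule LeastI[of "\<lambda>m. B \<le> disp (take m d)"]) (rule m0)
  have "first_hit B d \<le> m0"
    unfolding first_hit_def using m0 by (intro Least_le)
  with m0 show "first_hit B d \<le> length d" by simp
  show "disp (take m d) < B" if "m < first_hit B d"
    using not_less_Least[of m "\<lambda>m. B \<le> disp (take m d)"] that by (simp add: first_hit_def)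
qed

text \<open>By parity the path is at most at \<open>B - 2\<close> one cell earlier, and no step
  exceeds 2, so the last step is exactly 2. This forces a positive sign before it and an even
  increment, so the path is still moving upwards at the hit.\<close>

lemma at_first_hit:
  assumes "hits B d" "even B" "B > 0"
  shows "disp (take (first_hit B d) d) = B" and "even (sum_list (take (first_hit B d) d))"
proof -
  let ?T = "first_hit B d"
  have "?T \<noteq> 0" using first_hit_disp_ge[OF assms(1)] assms(3) by (intro notI) simp
  then obtain m where m: "?T = Suc m" by (cases ?T) auto
  have lt: "m < length d" using first_hit_le_length[OF assms(1)] m by simp
  have "disp (take m d) < B" using before_first_hit[OF assms(1)] m by simp
  then have le: "disp (take m d) \<le> B - 2"
    using even_disp[of "take m d"] assms(2) by presburger
  have ge: "B \<le> disp (take (Suc m) d)" using first_hit_disp_ge[OF assms(1)] m by simp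
  have st: "disp (take (Suc m) d) = disp (take m d) + (- 1) ^ sum_list (take m d) * (1 + (- 1) ^ (d ! m))"
    using disp_take_Suc[OF lt] .
  have ev: "even (sum_list (take m d))" "even (d ! m)"
    using le ge st by (cases "even (sum_list (take m d))"; cases "even (d ! m)"; simp)+
  then show "disp (take ?T d) = B" using le ge st m by simp
  show "even (sum_list (take ?T d))" using ev lt by (simp add: m take_Suc_conv_app_nth)
qed

text \<open>Prefixes up to the hit are untouched by the reversal, so the hit occurs at the same
  index. This is what makes \<open>reflect\<close> an involution.\<close>

lemma first_hit_reflect:
  assumes "hits B d"
  shows "first_hit B (reflect B d) = first_hit B d" and "hits B (reflect B d)"
proof -
  have tk: "take m (reflect B d) = take m d" if "m \<le> first_hit B d" for m
    using that first_hit_le_length[OF assms] by (simp add: reflect_def min_def)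
  show "first_hit B (reflect B d) = first_hit B d"
    unfolding first_hit_def[of B "reflect B d"]
  proof (rule Least_equality)
    show "B \<le> disp (take (first_hit B d) (reflect B d))"
      using first_hit_disp_ge[OF assms] tk by simp
  next
    fix m assume "B \<le> disp (take m (reflect B d))"
    then show "first_hit B d \<le> m"
      using before_first_hit[OF assms, of m] tk[of m] by (cases "m < first_hit B d") auto
  qed
  have "first_hit B d \<le> length (reflect B d)"
    using first_hit_le_length[OF assms] by (simp add: reflect_def)
  then show "hits B (reflect B d)"
    unfolding hits_def using tk[of "first_hit B d"] first_hit_disp_ge[OF assms] by auto
qed

lemma mset_reflect: "mset (reflect B d) = mset d"
proof -
  have "mset (reflect B d) = mset (take (first_hit B d) d @ drop (first_hit B d) d)"
    unfolding reflect_def mset_append mset_rev ..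
  then show ?thesis by simp
qed

lemma reflect_reflect:
  assumes "hits B d"
  shows "reflect B (reflect B d) = d"
  using first_hit_reflect(1)[OF assms] first_hit_le_length[OF assms]
  by (simp add: reflect_def)

text \<open>Up to the hit the displacement is \<open>B\<close> and the number of jumps is even, so
  the remainder has an odd sum and its reversal negates its displacement.\<close>

lemma disp_reflect:
  assumes "hits B d" "even B" "B > 0" "odd (sum_list d)"
  shows "disp (reflect B d) = 2 * B - disp d"
proof -
  let ?a = "take (first_hit B d) d" and ?b = "drop (first_hit B d) d"
  note a = at_first_hit[OF assms(1-3)]
  have "sum_list d = sum_list ?a + sum_list ?b"
    by (metis append_take_drop_id sum_list_append)
  then have b: "odd (sum_list ?b)" using a assms(4) by simp
  have "disp d = disp ?a + (-1) ^ sum_list ?a * disp ?b"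
    by (metis append_take_drop_id disp_append)
  moreover have "disp (reflect B d) = disp ?a + (-1) ^ sum_list ?a * disp (rev ?b)"
    by (simp only: reflect_def disp_append)
  ultimately show ?thesis using a b by (simp add: disp_rev)
qed

text \<open>The involution keeps length and sum and exchanges endpoints below and above
  \<open>B\<close>. Lists ending above \<open>B\<close> hit it automatically, so the target set
  needs no such condition.\<close>

lemma bij_betw_reflect:
  assumes "even B" "B > 0" "odd K"
  shows "bij_betw (reflect B) {d. length d = n \<and> sum_list d = K \<and> hits B d \<and> disp d < B}
           {d. length d = n \<and> sum_list d = K \<and> B < disp d}"
proof -
  have sum: "sum_list (reflect B d) = sum_list d" for d
    by (metis mset_reflect sum_mset_sum_list)
  have len: "length (reflect B d) = length d" for d
    by (metis mset_reflect size_mset)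
  have hit: "hits B d" if "B < disp d" for d
    using that unfolding hits_def by (intro exI[of _ "length d"]) auto
  show ?thesis
    using assms hit first_hit_reflect(2) reflect_reflect disp_reflect
    by (intro bij_betw_byWitness[where f' = "reflect B"]) (auto simp: sum len image_subset_iff)
qed

section \<open>Cyclic rotations with displacement in a given window\<close>

lemma card_nat_le_diameter:
  fixes I :: "nat set"
  assumes "\<And>i j. i \<in> I \<Longrightarrow> j \<in> I \<Longrightarrow> i \<le> j + W"
  shows "card I \<le> W + 1"
proof (cases "I = {}")
  case False
  let ?j = "LEAST j. j \<in> I"
  have j: "?j \<in> I" "\<And>i. i \<in> I \<Longrightarrow> ?j \<le> i"
    using False by (auto intro: LeastI Least_le)
  have "I \<subseteq> {?j..?j + W}" using assms j by auto
  then have "card I \<le> card {?j..?j + W}" by (intro card_mono) auto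
  then show ?thesis by simp
qed simp

text \<open>Equal partial sums force every entry between \<open>i\<close> and \<open>j\<close> to be
  0, so each of these cells contributes 2 in one and the same direction.\<close>

lemma disp_take_const:
  assumes "i \<le> j" "j \<le> length d" "sum_list (take i d) = sum_list (take j d)"
  shows "disp (take j d) = disp (take i d) + 2 * (- 1) ^ sum_list (take i d) * int (j - i)"
  using assms
proof (induction j rule: dec_induct)
  case (step m)
  have s: "sum_list (take (Suc m) d) = sum_list (take m d) + d ! m"
    using step by (simp add: take_Suc_conv_app_nth)
  have "take m d = take i d @ drop i (take m d)"
    using step by (metis append_take_drop_id min.absorb1 take_take)
  then have "sum_list (take i d) \<le> sum_list (take m d)"
    by (metis le_add1 sum_list_append)
  then have "sum_list (take i d) = sum_list (take m d)" "d ! m = 0"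
    using s step by auto
  then show ?case using step disp_take_Suc[of m d]
    by (simp add: algebra_simps Suc_diff_le)
qed simp

text \<open>Group the rotations by the number \<open>v\<close> of jumps in the prefix that is moved
  to the end; there are \<open>sum_list d + 1\<close> groups. Within a group the sign occurs
  squared, so the displacement drops by exactly 4 per cell. Two indices in the window then differ by
  at most half of \<open>W\<close>.\<close>

lemma card_rotate_window:
  fixes x :: real
  assumes "odd (sum_list d)"
  shows "card {i. i < length d \<and> \<bar>disp (rotate i d) - x\<bar> \<le> real W} \<le> (sum_list d + 1) * (W + 1)"
proof -
  let ?I = "\<lambda>v. {i. i < length d \<and> \<bar>disp (rotate i d) - x\<bar> \<le> real W \<and> sum_list (take i d) = v}"
  have card: "card (?I v) \<le> W + 1" for v
  proof (rule card_nat_le_diameter)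
    fix i j assume i: "i \<in> ?I v" and j: "j \<in> ?I v"
    show "i \<le> j + W"
    proof (cases "j \<le> i")
      case True
      have "disp (take i d) = disp (take j d) + 2 * (- 1) ^ v * int (i - j)"
        using disp_take_const[of j i d] True i j by auto
      moreover have "(- 1 :: int) ^ v * (- 1) ^ v = 1"
        by (simp flip: power_add power_mult_distrib)
      ultimately have "disp (rotate i d) = disp (rotate j d) - 4 * int (i - j)"
        using i j disp_rotate[OF assms, of i] disp_rotate[OF assms, of j] by (simp add: algebra_simps)
      then have "real_of_int (disp (rotate i d)) = disp (rotate j d) - 4 * (real i - real j)"
        using True by (simp add: of_nat_diff)
      moreover have "\<bar>disp (rotate i d) - x\<bar> \<le> real W" "\<bar>disp (rotate j d) - x\<bar> \<le> real W"
        using i j by auto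
      ultimately have "real i \<le> real j + real W" unfolding abs_le_iff using of_nat_0_le_iff[of W, where ?'a = real] by argo
      then show ?thesis by linarith
    qed simp
  qed
  have le: "sum_list (take i d) \<le> sum_list d" for i
    by (metis append_take_drop_id le_add1 sum_list_append)
  have "{i. i < length d \<and> \<bar>disp (rotate i d) - x\<bar> \<le> real W} \<subseteq> (\<Union>v\<le>sum_list d. ?I v)"
    using le by auto
  then have "card {i. i < length d \<and> \<bar>disp (rotate i d) - x\<bar> \<le> real W} \<le> card (\<Union>v\<le>sum_list d. ?I v)"
    by (intro card_mono) auto
  also have "\<dots> \<le> (\<Sum>v\<le>sum_list d. card (?I v))"
    by (intro card_UN_le) auto
  also have "\<dots> \<le> (\<Sum>v\<le>sum_list d. W + 1)"
    by (intro sum_mono card)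
  finally show ?thesis by simp
qed

section \<open>Discretisation of a path\<close>

definition increments :: "real \<Rightarrow> (real \<Rightarrow> nat) \<Rightarrow> nat \<Rightarrow> nat list" where
  "increments h f n = map (\<lambda>i. f (real (Suc i) * h) - f (real i * h)) [0..<n]"

lemma length_increments [simp]: "length (increments h f n) = n"
  by (simp add: increments_def)

lemma increments_Suc: "increments h f (Suc n) = increments h f n @ [f (real (Suc n) * h) - f (real n * h)]"
  by (simp add: increments_def)

lemma take_increments: "m \<le> n \<Longrightarrow> take m (increments h f n) = increments h f m"
  by (simp add: increments_def take_map)

lemma sum_list_increments:
  assumes "mono_on {0..} f" "h \<ge> 0"
  shows "sum_list (increments h f n) = f (real n * h) - f 0"
proof (induction n)
  case 0
  then show ?case by (simp add: increments_def)
next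
  case (Suc n)
  have "f 0 \<le> f (real n * h)" "f (real n * h) \<le> f (real (Suc n) * h)"
    using assms by (auto intro!: mono_onD[OF assms(1)] mult_right_mono)
  then show ?case using Suc by (simp add: increments_Suc)
qed

section \<open>Integrals of the sign of a counting path against trapezoid sums\<close>

lemma set_integrable_sign:
  fixes f :: "real \<Rightarrow> nat"
  assumes "mono_on {0..} f"
  shows "set_integrable lborel {0..s} (\<lambda>u. (- 1 :: real) ^ f u)"
proof -
  \<comment> \<open>Monotonicity is known on the nonnegative half-line only; the constant extension
    to the left is monotone everywhere, hence Borel.\<close>
  define g where "g u = real (f (max 0 u))" for u
  have "mono g" unfolding g_def using assms by (auto intro!: monoI mono_onD[OF assms])
  then have [measurable]: "g \<in> borel_measurable borel" by (rule borel_measurable_mono)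
  have eq: "(- 1 :: real) ^ nat \<lfloor>g u\<rfloor> = (- 1) ^ f u" if "u \<in> {0..s}" for u
    using that by (simp add: g_def)
  have "integrable lborel (\<lambda>u. indicator {0..s} u *\<^sub>R (- 1 :: real) ^ nat \<lfloor>g u\<rfloor>)"
    by (rule integrableI_bounded_set_indicator[where B = 1]) (auto simp: emeasure_lborel_Icc_eq)
  also have "(\<lambda>u. indicator {0..s} u *\<^sub>R (- 1 :: real) ^ nat \<lfloor>g u\<rfloor>) = (\<lambda>u. indicator {0..s} u *\<^sub>R (- 1 :: real) ^ f u)"
    using eq by (auto simp: indicator_def fun_eq_iff)
  finally show ?thesis by (simp add: set_integrable_def)
qed

lemma integrable_on_sign:
  fixes f :: "real \<Rightarrow> nat"
  assumes "mono_on {0..} f" "0 \<le> a"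
  shows "(\<lambda>u. (- 1 :: real) ^ f u) integrable_on {a..b}"
  using set_borel_integral_eq_integral(1)[OF set_integrable_sign[OF assms(1), of b]]
  by (rule integrable_on_subinterval) (use assms in auto)

lemma integral_sign_diff:
  fixes f :: "real \<Rightarrow> nat"
  assumes "mono_on {0..} f" "0 \<le> a" "a \<le> b"
  shows "integral {0..b} (\<lambda>u. (- 1 :: real) ^ f u) - integral {0..a} (\<lambda>u. (- 1) ^ f u)
    = integral {a..b} (\<lambda>u. (- 1) ^ f u)"
  using Henstock_Kurzweil_Integration.integral_combine[OF assms(2,3) integrable_on_sign[OF assms(1), of 0 b]] by simp

lemma integral_sign_bound:
  fixes f :: "real \<Rightarrow> nat"
  assumes "mono_on {0..} f" "0 \<le> a" "a \<le> b"
  shows "\<bar>integral {a..b} (\<lambda>u. (- 1 :: real) ^ f u)\<bar> \<le> b - a"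
proof -
  have "norm (integral {a..b} (\<lambda>u. (- 1 :: real) ^ f u)) \<le> integral {a..b} (\<lambda>u. 1)"
    by (intro integral_norm_bound_integral integrable_on_sign assms) auto
  then show ?thesis using assms(3) by simp
qed

text \<open>Only cells that contain a jump contribute to the error of the trapezoid sum, and there are
  at most \<open>f (n h)\<close> of them.\<close>

lemma integral_sign_approx:
  fixes f :: "real \<Rightarrow> nat"
  assumes mono: "mono_on {0..} f" and "f 0 = 0" and h: "h \<ge> 0"
  shows "\<bar>integral {0..real n * h} (\<lambda>u. (- 1) ^ f u) - h / 2 * disp (increments h f n)\<bar>
    \<le> 2 * h * f (real n * h)"
proof (induction n)
  case 0
  then show ?case using \<open>f 0 = 0\<close> by (simp add: increments_def)
next
  case (Suc n)
  let ?a = "real n * h" and ?b = "real (Suc n) * h"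
  let ?I = "integral {?a..?b} (\<lambda>u. (- 1 :: real) ^ f u)"
  have ab: "0 \<le> ?a" "?a \<le> ?b" using h by (auto intro: mult_right_mono)
  have fab: "f ?a \<le> f ?b" using ab by (intro mono_onD[OF mono]) auto
  have "disp (increments h f (Suc n)) =
      disp (increments h f n) + (- 1) ^ f ?a * (1 + (- 1) ^ (f ?b - f ?a))"
    using mono h \<open>f 0 = 0\<close> by (simp add: increments_Suc disp_append sum_list_increments)
  also have "(- 1 :: int) ^ f ?a * (1 + (- 1) ^ (f ?b - f ?a)) = (- 1) ^ f ?a + (- 1) ^ f ?b"
    using fab by (simp add: algebra_simps flip: power_add)
  finally have d: "disp (increments h f (Suc n)) = disp (increments h f n) + ((- 1) ^ f ?a + (- 1) ^ f ?b)" .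
  have cell: "\<bar>?I - h / 2 * ((- 1) ^ f ?a + (- 1) ^ f ?b)\<bar> \<le> 2 * h * (real (f ?b) - real (f ?a))"
  proof (cases "f ?a = f ?b")
    case True
    have "(- 1 :: real) ^ f u = (- 1) ^ f ?a" if "u \<in> {?a..?b}" for u
      using mono_onD[OF mono, of ?a u] mono_onD[OF mono, of u ?b] that ab True by auto
    then have "?I = integral {?a..?b} (\<lambda>u. (- 1 :: real) ^ f ?a)"
      by (rule Henstock_Kurzweil_Integration.integral_cong)
    also have "\<dots> = h * (- 1) ^ f ?a" using ab by (simp add: algebra_simps)
    finally show ?thesis using True by simp
  next
    case False
    \<comment> \<open>In a cell with a jump, the integral and the trapezoid term are each at most
      \<open>h\<close> in absolute value. This gives the factor 2 per jump.\<close>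
    then have "1 \<le> real (f ?b) - real (f ?a)" using fab by linarith
    then have "2 * h * 1 \<le> 2 * h * (real (f ?b) - real (f ?a))"
      using h by (intro mult_left_mono) auto
    moreover have "\<bar>?I\<bar> \<le> h"
      using integral_sign_bound[OF mono ab] by (simp add: algebra_simps)
    moreover have "\<bar>h / 2 * ((- 1) ^ f ?a + (- 1) ^ f ?b)\<bar> \<le> h"
      using h by (cases "even (f ?a)"; cases "even (f ?b)") auto
    ultimately show ?thesis by linarith
  qed
  have "integral {0..?b} (\<lambda>u. (- 1 :: real) ^ f u) = integral {0..?a} (\<lambda>u. (- 1) ^ f u) + ?I"
    using integral_sign_diff[OF mono ab] by simp
  moreover have "h / 2 * real_of_int (disp (increments h f (Suc n))) =
     h / 2 * disp (increments h f n) + h / 2 * ((- 1) ^ f ?a + (- 1) ^ f ?b)"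
    unfolding d by (simp add: algebra_simps)
  moreover have "2 * h * real (f ?b) = 2 * h * real (f ?a) + 2 * h * (real (f ?b) - real (f ?a))"
    by (simp add: algebra_simps)
  ultimately show ?case using Suc.IH cell by linarith
qed

section \<open>Maximum of the path against its maximum over the grid\<close>

definition max_disp :: "nat list \<Rightarrow> int" where
  "max_disp d = Max ((\<lambda>m. disp (take m d)) ` {..length d})"

lemma max_disp_ge_iff: "B \<le> max_disp d \<longleftrightarrow> hits B d"
  unfolding max_disp_def by (subst Max_ge_iff) (auto simp: hits_def)

text \<open>Each grid point competes with the maximiser \<open>s\<close>, which bounds the grid
  maximum. Conversely, the last grid point before \<open>s\<close> is at distance at most
  \<open>h\<close>, and the integral is 1-Lipschitz. The summand 1 in the bound pays for this gap,
  the rest for the trapezoid error.\<close>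

lemma max_integral_sign_approx:
  fixes f :: "real \<Rightarrow> nat"
  assumes mono: "mono_on {0..} f" and f0: "f 0 = 0" and h: "h > 0"
    and s: "s \<in> {0..real n * h}"
      "\<And>u. u \<in> {0..real n * h} \<Longrightarrow> integral {0..u} (\<lambda>u. (- 1 :: real) ^ f u) \<le> integral {0..s} (\<lambda>u. (- 1) ^ f u)"
  shows "\<bar>integral {0..s} (\<lambda>u. (- 1) ^ f u)
      - h / 2 * Max ((\<lambda>m. disp (take m (increments h f n))) ` {..length (increments h f n)})\<bar>
    \<le> h * (2 * f (real n * h) + 1)"
proof -
  let ?Y = "\<lambda>s. integral {0..s} (\<lambda>u. (- 1 :: real) ^ f u)"
  let ?A = "(\<lambda>m. disp (take m (increments h f n))) ` {..length (increments h f n)}"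
  have grid: "\<bar>?Y (real m * h) - h / 2 * disp (take m (increments h f n))\<bar> \<le> 2 * h * f (real n * h)"
    if "m \<le> n" for m
  proof -
    have "f (real m * h) \<le> f (real n * h)"
      using that h by (intro mono_onD[OF mono]) (auto intro: mult_right_mono)
    then have "2 * h * f (real m * h) \<le> 2 * h * f (real n * h)"
      using h by (intro mult_left_mono) auto
    moreover have "\<bar>?Y (real m * h) - h / 2 * disp (take m (increments h f n))\<bar> \<le> 2 * h * f (real m * h)"
      using integral_sign_approx[OF mono f0, of h m] h that by (simp add: take_increments)
    ultimately show ?thesis by linarith
  qed
  have "Max ?A \<in> ?A" by (intro Max_in) auto
  then obtain m where "m \<in> {..length (increments h f n)}" "Max ?A = disp (take m (increments h f n))"
    by (rule imageE)
  then have m: "m \<le> n" "Max ?A = disp (take m (increments h f n))" by simp_all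
  have "real m * h \<in> {0..real n * h}" using m h by (auto intro: mult_right_mono)
  from s(2)[OF this] have lower: "h / 2 * Max ?A \<le> ?Y s + 2 * h * f (real n * h)"
    using grid[OF m(1)] m(2) by simp
  define j where "j = nat \<lfloor>s / h\<rfloor>"
  have "real j = \<lfloor>s / h\<rfloor>" using s h by (simp add: j_def)
  then have "real j \<le> s / h" "s / h < real j + 1" by linarith+
  then have j: "real j * h \<le> s" "s - real j * h \<le> h"
    using h by (simp_all add: field_simps)
  have "s / h \<le> real n" using s h by (simp add: field_simps)
  with \<open>real j \<le> s / h\<close> have jn: "j \<le> n" by linarith
  have "disp (take j (increments h f n)) \<le> Max ?A" using jn by (intro Max_ge) auto
  then have "h / 2 * disp (take j (increments h f n)) \<le> h / 2 * Max ?A"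
    using h by (intro mult_left_mono) auto
  moreover have "?Y s - ?Y (real j * h) \<le> h"
    using integral_sign_diff[OF mono, of "real j * h" s] integral_sign_bound[OF mono, of "real j * h" s] j h by simp
  ultimately have "?Y s \<le> h / 2 * Max ?A + 2 * h * f (real n * h) + h"
    using grid[OF jn] by linarith
  with lower show ?thesis using h by (simp add: algebra_simps)
qed

section \<open>Exchangeability of the Poisson increments\<close>

text \<open>Both sides are sums of point probabilities over countably many values, and the bijection
  reindexes one sum into the other.\<close>

lemma prob_countable_bij:
  fixes f :: "'a \<Rightarrow> 'b :: countable"
  assumes "prob_space M" and f: "f \<in> measurable M (count_space UNIV)"
    and E: "E \<in> sets M"
    and bij: "bij_betw \<Phi> A B"
    and eq: "\<And>d. d \<in> A \<Longrightarrow> measure M {\<omega>\<in>E. f \<omega> = d} = measure M {\<omega>\<in>E. f \<omega> = \<Phi> d}"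
  shows "measure M {\<omega>\<in>E. f \<omega> \<in> A} = measure M {\<omega>\<in>E. f \<omega> \<in> B}"
proof -
  interpret prob_space M by fact
  note [measurable] = f E
  have sub: "E \<subseteq> space M" using E by (rule sets.sets_into_space)
  have s: "{\<omega>\<in>E. f \<omega> = d} \<in> sets M" for d
  proof -
    have "{\<omega>\<in>E. f \<omega> = d} = E \<inter> (f -` {d} \<inter> space M)" using sub by auto
    also have "\<dots> \<in> sets M" by measurable
    finally show ?thesis .
  qed
  have *: "emeasure M {\<omega>\<in>E. f \<omega> \<in> X} = (\<integral>\<^sup>+d. emeasure M {\<omega>\<in>E. f \<omega> = d} \<partial>count_space X)" for X
  proof -
    have "{\<omega>\<in>E. f \<omega> \<in> X} = (\<Union>d\<in>X. {\<omega>\<in>E. f \<omega> = d})" by auto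
    then show ?thesis
      using s by (simp only:) (intro emeasure_UN_countable, auto simp: disjoint_family_on_def)
  qed
  have "emeasure M {\<omega>\<in>E. f \<omega> \<in> A} = (\<integral>\<^sup>+d. emeasure M {\<omega>\<in>E. f \<omega> = \<Phi> d} \<partial>count_space A)"
    unfolding * by (intro nn_integral_cong) (simp add: emeasure_eq_measure eq)
  also have "\<dots> = emeasure M {\<omega>\<in>E. f \<omega> \<in> B}"
    unfolding * by (rule nn_integral_bij_count_space[OF bij])
  finally show ?thesis by (simp add: emeasure_eq_measure)
qed

lemma mset_rotate: "mset (rotate i xs) = mset xs"
proof -
  have "mset (rotate i xs) = mset (take (i mod length xs) xs @ drop (i mod length xs) xs)"
    unfolding rotate_drop_take mset_append by (rule add.commute)
  then show ?thesis by simp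
qed

lemma bij_betw_rotate_vimage:
  fixes A :: "'a list set"
  shows "bij_betw (rotate i) {d. rotate i d \<in> A} A"
proof -
  have bij: "bij (rotate i :: 'a list \<Rightarrow> _)"
    unfolding rotate_def by (intro bij_fn bij_rotate1)
  then have "rotate i ` (rotate i -` A) = A"
    by (intro surj_image_vimage_eq bij_is_surj)
  then show ?thesis
    using bij_betw_subset[OF bij subset_UNIV] by (simp only: vimage_def)
qed

context symmetric_telegraph
begin

definition incs :: "real \<Rightarrow> nat \<Rightarrow> 'a \<Rightarrow> nat list" where
  "incs h n \<omega> = increments h (\<lambda>s. N s \<omega>) n"

lemma incs_eq_iff:
  "incs h n \<omega> = d \<longleftrightarrow> length d = n \<and> (\<forall>i<n. N (real (Suc i) * h) \<omega> - N (real i * h) \<omega> = d ! i)"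
  by (auto simp: incs_def increments_def list_eq_iff_nth_eq)

lemma measurable_incs [measurable]:
  assumes "h \<ge> 0"
  shows "incs h n \<in> measurable M (count_space UNIV)"
proof -
  have [measurable]: "N (real i * h) \<in> measurable M (count_space UNIV)" for i
    using assms by (intro random_variable_N) simp
  have "incs h n -` {d} \<inter> space M \<in> sets M" for d
  proof -
    have "incs h n -` {d} \<inter> space M =
      {\<omega>\<in>space M. length d = n \<and> (\<forall>i<n. N (real (Suc i) * h) \<omega> - N (real i * h) \<omega> = d ! i)}"
      by (simp add: incs_eq_iff vimage_def Int_def conj_commute)
    also have "\<dots> \<in> sets M" by measurable
    finally show ?thesis .
  qed
  then show ?thesis by (subst measurable_count_space_eq2_countable) auto
qed

text \<open>As a product over the list, the probability visibly depends only on the multiset of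
  increments.\<close>

lemma prob_incs_eq:
  assumes h: "h > 0" and n: "n > 0" "length d = n"
  shows "prob {\<omega>\<in>space M. incs h n \<omega> = d} = (\<Prod>x\<leftarrow>d. pmf (poisson_pmf (rate * h)) x)"
proof -
  let ?X = "\<lambda>i \<omega>. N (real (Suc i) * h) \<omega> - N (real i * h) \<omega>"
  have indep: "indep_vars (\<lambda>_. count_space UNIV) ?X {..<n}"
    using h independent_increments[of "\<lambda>i. real i * h" n] by (simp add: mult_strict_right_mono)
  have "{\<omega>\<in>space M. incs h n \<omega> = d} = (\<Inter>i\<in>{..<n}. ?X i -` {d ! i} \<inter> space M)"
    using n by (auto simp: incs_eq_iff)
  also have "prob \<dots> = (\<Prod>i<n. prob (?X i -` {d ! i} \<inter> space M))"
    using n by (intro indep_varsD_finite[OF indep]) auto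
  also have "\<dots> = (\<Prod>i<n. pmf (poisson_pmf (rate * h)) (d ! i))"
  proof (intro prod.cong refl)
    fix i
    have [measurable]: "N (real j * h) \<in> measurable M (count_space UNIV)" for j
      using h by (intro random_variable_N) simp
    have "?X i \<in> measurable M (count_space UNIV)" by measurable
    then have "prob (?X i -` {d ! i} \<inter> space M) = measure (distr M (count_space UNIV) (?X i)) {d ! i}"
      by (simp add: measure_distr)
    also have "distr M (count_space UNIV) (?X i) = measure_pmf (poisson_pmf (rate * h))"
      using poisson_increments[of "real i * h" "real (Suc i) * h"] h by (simp add: algebra_simps)
    finally show "prob (?X i -` {d ! i} \<inter> space M) = pmf (poisson_pmf (rate * h)) (d ! i)"
      by (simp add: pmf.rep_eq)
  qed
  finally show ?thesis
    using n by (simp add: prod.list_conv_set_nth atLeast0LessThan)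
qed

lemma prob_V0_incs_eq:
  assumes h: "h > 0"
  shows "prob {\<omega>\<in>space M. V0 \<omega> = c \<and> incs h n \<omega> = d} = 1 / 2 * prob {\<omega>\<in>space M. incs h n \<omega> = d}"
proof -
  let ?P = "Pi\<^sub>M {0..} (\<lambda>_. count_space UNIV) :: (real \<Rightarrow> nat) measure"
  have [measurable]: "(\<lambda>x. x (real i * h)) \<in> measurable ?P (count_space UNIV)" for i
    using h by (intro measurable_component_singleton) simp
  have 1: "{\<omega>\<in>space M. V0 \<omega> = c} \<in> sets (vimage_algebra (space M) V0 borel)"
    using in_vimage_algebra[of "{c}" borel V0 "space M"] by (simp add: vimage_def Int_def conj_commute)
  \<comment> \<open>Independence is available for the generated algebras, so the event is exhibited
    as the preimage of a measurable cylinder. Restricting paths to nonnegative times loses nothing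
    at grid times.\<close>
  let ?D = "{x\<in>space ?P. length d = n \<and> (\<forall>i<n. x (real (Suc i) * h) - x (real i * h) = d ! i)}"
  have "?D \<in> sets ?P" by measurable
  from in_vimage_algebra[OF this, of "\<lambda>\<omega>. \<lambda>t\<in>{0..}. N t \<omega>" "space M"]
  have "(\<lambda>\<omega>. \<lambda>t\<in>{0..}. N t \<omega>) -` ?D \<inter> space M
    \<in> sets (vimage_algebra (space M) (\<lambda>\<omega>. \<lambda>t\<in>{0..}. N t \<omega>) ?P)" .
  also have "(\<lambda>\<omega>. \<lambda>t\<in>{0..}. N t \<omega>) -` ?D \<inter> space M = {\<omega>\<in>space M. incs h n \<omega> = d}"
    using h by (auto simp: incs_eq_iff space_PiM)
  finally have 2: "{\<omega>\<in>space M. incs h n \<omega> = d}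
    \<in> sets (vimage_algebra (space M) (\<lambda>\<omega>. \<lambda>t\<in>{0..}. N t \<omega>) ?P)" .
  have "{\<omega>\<in>space M. V0 \<omega> = c \<and> incs h n \<omega> = d} = {\<omega>\<in>space M. V0 \<omega> = c} \<inter> {\<omega>\<in>space M. incs h n \<omega> = d}"
    by auto
  then show ?thesis
    using indep_setD[OF V0_indep_N 1 2] V0_pos by simp
qed

text \<open>Point probabilities depend only on the multiset of the list, and the independent initial
  velocity contributes the same factor 1/2 to each. One statement serves both reflection and
  rotation.\<close>

lemma incs_exchangeable:
  assumes h: "h > 0" and n: "n > 0" and bij: "bij_betw \<Phi> A B"
    and A: "\<And>d. d \<in> A \<Longrightarrow> mset (\<Phi> d) = mset d"
  shows "prob {\<omega>\<in>space M. V0 \<omega> = c \<and> incs h n \<omega> \<in> A} = prob {\<omega>\<in>space M. V0 \<omega> = c \<and> incs h n \<omega> \<in> B}"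
proof -
  have E: "{\<omega>\<in>space M. V0 \<omega> = c} \<in> sets M"
    using random_variable_V0 by measurable
  have eq: "prob {\<omega>\<in>space M. incs h n \<omega> = d} = prob {\<omega>\<in>space M. incs h n \<omega> = d'}"
    if "mset d' = mset d" for d d'
  proof (cases "length d = n")
    case True
    then have "length d' = n" using that by (metis size_mset)
    with True show ?thesis
      using prob_incs_eq[OF h n, of d] prob_incs_eq[OF h n, of d'] that
      by (simp flip: prod_mset_prod_list)
  next
    case False
    then have "length d' \<noteq> n" using that by (metis size_mset)
    with False have "{\<omega>\<in>space M. incs h n \<omega> = d} = {}" "{\<omega>\<in>space M. incs h n \<omega> = d'} = {}"
      by (auto simp: incs_def)
    then show ?thesis by (simp only:)
  qed
  have "prob {\<omega>\<in>{\<omega>\<in>space M. V0 \<omega> = c}. incs h n \<omega> \<in> A} = prob {\<omega>\<in>{\<omega>\<in>space M. V0 \<omega> = c}. incs h n \<omega> \<in> B}"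
  proof (rule prob_countable_bij[OF prob_space_axioms _ E bij])
    show "incs h n \<in> measurable M (count_space UNIV)" using h by simp
    fix d assume "d \<in> A"
    then show "prob {\<omega>\<in>{\<omega>\<in>space M. V0 \<omega> = c}. incs h n \<omega> = d} = prob {\<omega>\<in>{\<omega>\<in>space M. V0 \<omega> = c}. incs h n \<omega> = \<Phi> d}"
      using eq[OF A[of d]] prob_V0_incs_eq[OF h, of n d] prob_V0_incs_eq[OF h, of n "\<Phi> d"] by simp
  qed
  then show ?thesis by (simp add: conj_assoc)
qed

text \<open>Averaging over all cyclic rotations: between jumps, rotating by one more cell shifts \<open>disp\<close>
  by exactly 4, so only boundedly many rotations fall into a given window.\<close>

lemma prob_window_le:
  fixes x :: real
  assumes h: "h > 0" and n: "n > 0" and K: "odd K"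
  shows "prob {\<omega>\<in>space M. V0 \<omega> = c \<and> incs h n \<omega> \<in> {d. length d = n \<and> sum_list d = K \<and> \<bar>disp d - x\<bar> \<le> real W}}
    \<le> (K + 1) * (W + 1) / n"
proof -
  let ?A = "{d. length d = n \<and> sum_list d = K \<and> \<bar>disp d - x\<bar> \<le> real W}"
  let ?E = "\<lambda>i. {\<omega>\<in>space M. V0 \<omega> = c \<and> incs h n \<omega> \<in> {d. rotate i d \<in> ?A}}"
  have [measurable]: "incs h n \<in> measurable M (count_space UNIV)" using h by simp
  note [measurable] = random_variable_V0
  have E [measurable]: "?E i \<in> sets M" for i
    by measurable
  have int: "integrable M (indicator (?E i) :: _ \<Rightarrow> real)" for i
    using E by (rule integrable_real_indicator) (simp add: emeasure_eq_measure)
  have sl: "sum_list (rotate i d) = sum_list d" for i and d :: "nat list"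
    by (metis mset_rotate sum_mset_sum_list)
  \<comment> \<open>Rotation preserves the law, so all the events \<open>?E i\<close> are equally
    likely. Their probabilities sum to the expected number of rotations in the window, a number that
    is bounded pointwise.\<close>
  have "real n * prob (?E 0) = (\<Sum>i<n. prob (?E i))"
    using incs_exchangeable[OF h n bij_betw_rotate_vimage[of _ ?A] mset_rotate] by simp
  also have "\<dots> = (\<Sum>i<n. expectation (indicator (?E i)))"
    unfolding Bochner_Integration.integral_indicator Int_absorb2[OF sets.sets_into_space[OF E]] ..
  also have "\<dots> = expectation (\<lambda>\<omega>. \<Sum>i<n. indicator (?E i) \<omega>)"
    using int by (rule Bochner_Integration.integral_sum[symmetric])
  also have "\<dots> \<le> (K + 1) * (W + 1)"
  proof (rule integral_le_const)
    show "integrable M (\<lambda>\<omega>. \<Sum>i<n. indicator (?E i) \<omega> :: real)"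
      using int by (rule Bochner_Integration.integrable_sum)
    have "(\<Sum>i<n. indicator (?E i) \<omega> :: real) \<le> (K + 1) * (W + 1)" for \<omega>
    proof (cases "sum_list (incs h n \<omega>) = K")
      case True
      let ?d = "incs h n \<omega>"
      have len: "length ?d = n" by (simp add: incs_def)
      have "(\<Sum>i<n. indicator (?E i) \<omega> :: real) \<le> (\<Sum>i<n. of_bool (\<bar>disp (rotate i ?d) - x\<bar> \<le> real W))"
        by (intro sum_mono) (auto simp: indicator_def)
      also have "\<dots> = card {i. i < length ?d \<and> \<bar>disp (rotate i ?d) - x\<bar> \<le> real W}"
        by (simp add: len sum.If_cases of_bool_def Int_def)
      also have "\<dots> \<le> (K + 1) * (W + 1)"
        using card_rotate_window[of ?d x W] True K by (simp only: of_nat_le_iff not_False_eq_True simp_thms)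
      finally show ?thesis by simp
    next
      case False
      then have "\<omega> \<notin> ?E i" for i by (auto simp: sl)
      then have "(\<Sum>i<n. indicator (?E i) \<omega> :: real) = 0" by (intro sum.neutral) auto
      then show ?thesis by simp
    qed
    then show "AE \<omega> in M. (\<Sum>i<n. indicator (?E i) \<omega>) \<le> real ((K + 1) * (W + 1))" by simp
  qed
  finally show ?thesis using n by (simp add: field_simps)
qed

text \<open>The discrete reflection principle: \<open>reflect\<close> merely permutes the
  increments.\<close>

lemma prob_hits_below_eq_prob_above:
  assumes h: "h > 0" and n: "n > 0" and K: "odd K" and B: "even B" "B > 0"
  shows "prob {\<omega>\<in>space M. V0 \<omega> = c \<and> incs h n \<omega> \<in> {d. length d = n \<and> sum_list d = K \<and> hits B d \<and> disp d < B}}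
    = prob {\<omega>\<in>space M. V0 \<omega> = c \<and> incs h n \<omega> \<in> {d. length d = n \<and> sum_list d = K \<and> B < disp d}}"
  by (intro incs_exchangeable[OF h n bij_betw_reflect] B K mset_reflect)

end

section \<open>Passage to the limit\<close>

text \<open>On \<open>E\<close> the function is a pointwise limit of measurable ones. Nothing is
  known about it outside \<open>E\<close>, hence the restricted space.\<close>

lemma sets_approximable:
  fixes f :: "'a \<Rightarrow> real"
  assumes E: "E \<in> sets M" and A: "A \<in> sets borel"
    and g: "\<And>n. g n \<in> borel_measurable M" and e: "e \<longlonglongrightarrow> 0"
    and approx: "\<And>n \<omega>. \<omega> \<in> E \<Longrightarrow> \<bar>f \<omega> - g n \<omega>\<bar> \<le> e n"
  shows "{\<omega>\<in>E. f \<omega> \<in> A} \<in> sets M"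
proof -
  have sub: "E \<subseteq> space M" using E by (rule sets.sets_into_space)
  have "f \<in> borel_measurable (restrict_space M E)"
  proof (rule borel_measurable_LIMSEQ_real)
    show "g n \<in> borel_measurable (restrict_space M E)" for n
      using g by (rule measurable_restrict_space1)
    fix \<omega> assume "\<omega> \<in> space (restrict_space M E)"
    then have "\<omega> \<in> E" by (simp add: space_restrict_space)
    then have "(\<lambda>n. g n \<omega> - f \<omega>) \<longlonglongrightarrow> 0"
      using approx by (intro Lim_null_comparison[OF _ e] always_eventually) (simp add: abs_minus_commute)
    then show "(\<lambda>n. g n \<omega>) \<longlonglongrightarrow> f \<omega>" by (simp add: LIM_zero_iff)
  qed
  from measurable_sets[OF this A] have "f -` A \<inter> E \<in> sets (restrict_space M E)"
    using sub by (simp add: space_restrict_space Int_absorb2)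
  then have "f -` A \<inter> E \<in> sets M"
    using E sub by (simp add: sets_restrict_space_iff Int_absorb2)
  also have "f -` A \<inter> E = {\<omega>\<in>E. f \<omega> \<in> A}" by auto
  finally show ?thesis .
qed

text \<open>The events increase with \<open>n\<close>, and strictness of the inequality makes their
  union the limit event. Continuity from below then applies.\<close>

lemma (in finite_measure) measure_greater_tendsto:
  fixes f :: "'a \<Rightarrow> real"
  assumes meas: "\<And>y. {\<omega>\<in>E. f \<omega> > y} \<in> sets M" and "C \<ge> 0"
  shows "(\<lambda>n. measure M {\<omega>\<in>E. f \<omega> > x + C / Suc n}) \<longlonglongrightarrow> measure M {\<omega>\<in>E. f \<omega> > x}"
proof -
  have lim: "(\<lambda>n. x + C / Suc n) \<longlonglongrightarrow> x"
    using tendsto_add[OF tendsto_const LIMSEQ_Suc[OF lim_const_over_n[of C]], of x] by simp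
  have "(\<Union>n. {\<omega>\<in>E. f \<omega> > x + C / Suc n}) = {\<omega>\<in>E. f \<omega> > x}"
  proof (intro equalityI subsetI)
    fix \<omega> assume \<omega>: "\<omega> \<in> {\<omega>\<in>E. f \<omega> > x}"
    then have "eventually (\<lambda>n. x + C / Suc n < f \<omega>) sequentially"
      using lim by (intro order_tendstoD) auto
    then obtain n where "x + C / Suc n < f \<omega>"
      using eventually_happens'[OF sequentially_bot] by blast
    with \<omega> show "\<omega> \<in> (\<Union>n. {\<omega>\<in>E. f \<omega> > x + C / Suc n})" by blast
  next
    fix \<omega> assume "\<omega> \<in> (\<Union>n. {\<omega>\<in>E. f \<omega> > x + C / Suc n})"
    then obtain n where "\<omega> \<in> E" "x + C / Suc n < f \<omega>" by blast
    moreover have "0 \<le> C / Suc n" using \<open>C \<ge> 0\<close> by simp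
    ultimately show "\<omega> \<in> {\<omega>\<in>E. f \<omega> > x}" by simp
  qed
  moreover have "incseq (\<lambda>n. {\<omega>\<in>E. f \<omega> > x + C / Suc n})"
  proof (rule incseq_SucI, rule subsetI)
    fix n \<omega> assume "\<omega> \<in> {\<omega>\<in>E. f \<omega> > x + C / Suc n}"
    moreover have "C / Suc (Suc n) \<le> C / Suc n"
      using \<open>C \<ge> 0\<close> by (intro divide_left_mono) auto
    ultimately show "\<omega> \<in> {\<omega>\<in>E. f \<omega> > x + C / Suc (Suc n)}" by auto
  qed
  ultimately show ?thesis
    using finite_Lim_measure_incseq[of "\<lambda>n. {\<omega>\<in>E. f \<omega> > x + C / Suc n}"] meas by auto
qed

section \<open>The telegraph path and its discretisation\<close>

context symmetric_telegraph
begin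

lemma telegraph_eq_integral:
  assumes "\<omega> \<in> space M" "V0 \<omega> = c"
  shows "telegraph V0 N s \<omega> = c * integral {0..s} (\<lambda>u. (- 1) ^ N u \<omega>)"
proof -
  have "telegraph V0 N s \<omega> = c * (LBINT u:{0..s}. (- 1) ^ N u \<omega>)"
    unfolding telegraph_def using assms(2) by (simp add: set_integral_mult_right)
  then show ?thesis
    by (simp add: set_borel_integral_eq_integral(2)[OF set_integrable_sign[OF N_mono[OF assms(1)]]])
qed

lemma telegraph_path_approx:
  assumes \<omega>: "\<omega> \<in> space M" "V0 \<omega> = c" "N t \<omega> = K" and t: "t > 0" and n: "n > 0"
  shows "sum_list (incs (t / n) n \<omega>) = K"
    and "\<bar>telegraph V0 N t \<omega> - c * (t / n) / 2 * disp (incs (t / n) n \<omega>)\<bar> \<le> c * real (2 * K + 1) * (t / n)"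
    and "\<bar>running_max (telegraph V0 N) t \<omega> - c * (t / n) / 2 * max_disp (incs (t / n) n \<omega>)\<bar>
      \<le> c * real (2 * K + 1) * (t / n)"
    and "telegraph V0 N t \<omega> \<le> running_max (telegraph V0 N) t \<omega>"
proof -
  let ?Y = "\<lambda>s. integral {0..s} (\<lambda>u. (- 1 :: real) ^ N u \<omega>)"
  let ?h = "t / n"
  note mono = N_mono[OF \<omega>(1)]
  note N0 = N_0[OF \<omega>(1)]
  note tel = telegraph_eq_integral[OF \<omega>(1,2)]
  have h: "?h > 0" "real n * ?h = t" using t n by auto
  have scale: "\<bar>c * y - c * ?h / 2 * z\<bar> \<le> c * real (2 * K + 1) * ?h"
    if "\<bar>y - ?h / 2 * z\<bar> \<le> ?h * real (2 * K + 1)" for y z :: real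
  proof -
    have "\<bar>c * y - c * ?h / 2 * z\<bar> = c * \<bar>y - ?h / 2 * z\<bar>"
      using speed_pos by (simp add: abs_mult_pos' right_diff_distrib mult.assoc)
    also have "\<dots> \<le> c * (?h * real (2 * K + 1))"
      using that speed_pos by (intro mult_left_mono) auto
    finally show ?thesis by (simp only: mult_ac)
  qed
  show "sum_list (incs ?h n \<omega>) = K"
    using sum_list_increments[OF mono, of ?h n] h N0 \<omega>(3) by (simp add: incs_def)
  have "\<bar>?Y t - ?h / 2 * disp (incs ?h n \<omega>)\<bar> \<le> 2 * ?h * K"
    using integral_sign_approx[OF mono N0, of ?h n] h \<omega>(3) by (simp add: incs_def)
  \<comment> \<open>Weakened to the bound for the maximum, so that endpoint and maximum share one
    error term.\<close>
  also have "\<dots> \<le> ?h * real (2 * K + 1)" using h by (simp add: algebra_simps)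
  finally show "\<bar>telegraph V0 N t \<omega> - c * ?h / 2 * disp (incs ?h n \<omega>)\<bar> \<le> c * real (2 * K + 1) * ?h"
    unfolding tel by (rule scale)
  \<comment> \<open>Continuity ensures that the maximum is attained, so that the
    \<open>GREATEST\<close> in \<open>running_max\<close> has its intended value.\<close>
  have "continuous_on {0..t} ?Y"
    by (intro indefinite_integral_continuous_1 integrable_on_sign mono) simp
  then have "continuous_on {0..t} (\<lambda>s. telegraph V0 N s \<omega>)"
    unfolding tel by (intro continuous_intros)
  from running_max_attained[where X = "telegraph V0 N", OF this] t obtain s
    where s: "s \<in> {0..t}" "running_max (telegraph V0 N) t \<omega> = telegraph V0 N s \<omega>"
      "\<And>u. u \<in> {0..t} \<Longrightarrow> telegraph V0 N u \<omega> \<le> telegraph V0 N s \<omega>"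
    by auto
  then show "telegraph V0 N t \<omega> \<le> running_max (telegraph V0 N) t \<omega>" using t by simp
  have "?Y u \<le> ?Y s" if "u \<in> {0..t}" for u
    using s(3)[OF that] speed_pos by (simp add: tel)
  then have "\<bar>?Y s - ?h / 2 * max_disp (incs ?h n \<omega>)\<bar> \<le> ?h * real (2 * K + 1)"
    using max_integral_sign_approx[OF mono N0 h(1), of s n] s(1) \<omega>(3)
    unfolding h(2) max_disp_def incs_def by simp
  then show "\<bar>running_max (telegraph V0 N) t \<omega> - c * ?h / 2 * max_disp (incs ?h n \<omega>)\<bar>
      \<le> c * real (2 * K + 1) * ?h"
    unfolding s(2) tel by (rule scale)
qed

end

section \<open>The continuous reflection principle for an odd number of jumps\<close>

locale telegraph_odd = symmetric_telegraph M N rate V0 c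
  for M :: "'a measure" and N rate V0 c +
  fixes t :: real and K :: nat
  assumes t: "t > 0" and K: "odd K"
begin

abbreviation "T \<equiv> telegraph V0 N t"
abbreviation "S \<equiv> running_max (telegraph V0 N) t"

definition E :: "'a set" where
  "E = {\<omega>\<in>space M. N t \<omega> = K \<and> V0 \<omega> = c}"

text \<open>The shift to \<open>Suc n\<close> cells gives a proper grid for every
  \<open>n\<close>.\<close>

definition mesh :: "nat \<Rightarrow> real" where
  "mesh n = t / Suc n"

definition D :: "nat \<Rightarrow> 'a \<Rightarrow> nat list" where
  "D n = incs (mesh n) (Suc n)"

lemma mesh_pos: "mesh n > 0"
  using t by (simp add: mesh_def)

lemma measurable_D [measurable]: "D n \<in> measurable M (count_space UNIV)"
  unfolding D_def using mesh_pos[of n] by simp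

lemma E_sets [measurable]: "E \<in> sets M"
proof -
  have [measurable]: "N t \<in> measurable M (count_space UNIV)"
    using t by (intro random_variable_N) simp
  show ?thesis unfolding E_def using random_variable_V0 by measurable
qed

text \<open>The increments sum to \<open>N t\<close>, so for every grid the conditioning event can
  be read off \<open>V0\<close> and the list alone, as the exchangeability results require.\<close>

lemma E_eq: "E = {\<omega>\<in>space M. V0 \<omega> = c \<and> sum_list (D n \<omega>) = K}"
proof -
  have "sum_list (D n \<omega>) = N t \<omega>" if "\<omega> \<in> space M" for \<omega>
    using sum_list_increments[OF N_mono[OF that], of "mesh n" "Suc n"] N_0[OF that] t
    by (simp add: D_def incs_def mesh_def)
  then show ?thesis by (auto simp: E_def)
qed

lemma path_approx:
  assumes "\<omega> \<in> E"
  shows "\<bar>T \<omega> - c * mesh n / 2 * disp (D n \<omega>)\<bar> \<le> c * real (2 * K + 1) * mesh n"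
    and "\<bar>S \<omega> - c * mesh n / 2 * max_disp (D n \<omega>)\<bar> \<le> c * real (2 * K + 1) * mesh n"
    and "T \<omega> \<le> S \<omega>"
  using telegraph_path_approx[of \<omega> t K "Suc n"] assms t
  unfolding E_def mesh_def D_def by auto

text \<open>On \<open>E\<close> both variables are approximated uniformly by functions of
  \<open>D n\<close>, with an error that tends to 0.\<close>

lemma
  assumes "A \<in> sets borel"
  shows sets_T: "{\<omega>\<in>E. T \<omega> \<in> A} \<in> sets M" and sets_S: "{\<omega>\<in>E. S \<omega> \<in> A} \<in> sets M"
proof -
  have lim: "(\<lambda>n. c * real (2 * K + 1) * mesh n) \<longlonglongrightarrow> 0"
    using LIMSEQ_Suc[OF lim_const_over_n[of "c * real (2 * K + 1) * t"]] by (simp add: mesh_def)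
  show "{\<omega>\<in>E. T \<omega> \<in> A} \<in> sets M"
    by (rule sets_approximable[OF E_sets assms _ lim path_approx(1)]) measurable
  show "{\<omega>\<in>E. S \<omega> \<in> A} \<in> sets M"
    by (rule sets_approximable[OF E_sets assms _ lim path_approx(2)]) measurable
qed

lemma sets_D: "{\<omega>\<in>E. P (D n \<omega>)} \<in> sets M"
proof -
  have "{\<omega>\<in>E. P (D n \<omega>)} = E \<inter> (D n -` Collect P \<inter> space M)"
    by (auto simp: E_def)
  also have "\<dots> \<in> sets M" by measurable
  finally show ?thesis .
qed

lemma prob_hits_below_eq_D:
  assumes "even B" "B > 0"
  shows "prob {\<omega>\<in>E. hits B (D n \<omega>) \<and> disp (D n \<omega>) < B} = prob {\<omega>\<in>E. B < disp (D n \<omega>)}"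
proof -
  have "length (D n \<omega>) = Suc n" for \<omega> by (simp add: D_def incs_def)
  then show ?thesis
    using prob_hits_below_eq_prob_above[OF mesh_pos _ K assms, of "Suc n" n] unfolding E_eq[of n]
    by (simp add: D_def[symmetric] conj_assoc)
qed

lemma window_D:
  fixes x :: real
  shows "prob {\<omega>\<in>E. \<bar>disp (D n \<omega>) - x\<bar> \<le> real W} \<le> (K + 1) * (W + 1) / Suc n"
proof -
  have "{\<omega>\<in>E. \<bar>disp (D n \<omega>) - x\<bar> \<le> real W} = {\<omega>\<in>space M. V0 \<omega> = c \<and>
      incs (mesh n) (Suc n) \<omega> \<in> {d. length d = Suc n \<and> sum_list d = K \<and> \<bar>disp d - x\<bar> \<le> real W}}"
    unfolding E_eq[of n] D_def by (auto simp: incs_def)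
  then show ?thesis
    using prob_window_le[OF mesh_pos _ K, of "Suc n" n x W] by (simp only: zero_less_Suc simp_thms of_nat_mult of_nat_add of_nat_1)
qed

text \<open>The approximation error doubles the width of the window. Dividing by
  \<open>c * mesh n / 2\<close>, the unit of \<open>disp\<close>, turns it into
  \<open>4 * (2 * K + 1)\<close>.\<close>

lemma window_T:
  "prob {\<omega>\<in>E. \<bar>T \<omega> - x\<bar> \<le> c * real (2 * K + 1) * mesh n} \<le> (K + 1) * (4 * (2 * K + 1) + 1) / Suc n"
proof -
  have "{\<omega>\<in>E. \<bar>T \<omega> - x\<bar> \<le> c * real (2 * K + 1) * mesh n}
      \<subseteq> {\<omega>\<in>E. \<bar>disp (D n \<omega>) - 2 * x / (c * mesh n)\<bar> \<le> real (4 * (2 * K + 1))}"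
  proof safe
    fix \<omega> assume \<omega>: "\<omega> \<in> E" and T: "\<bar>T \<omega> - x\<bar> \<le> c * real (2 * K + 1) * mesh n"
    have alg: "y / 2 * z - x = y / 2 * (z - 2 * x / y)" if "y > 0" for y z :: real
      using that by (simp add: field_simps)
    have alg': "\<bar>y / 2 * z\<bar> = y / 2 * \<bar>z\<bar>" if "y > 0" for y z :: real
      using that by (simp add: abs_mult)
    let ?a = "c * mesh n"
    have a: "?a > 0" using speed_pos mesh_pos by simp
    have "\<bar>?a / 2 * disp (D n \<omega>) - x\<bar> \<le> 2 * (c * real (2 * K + 1) * mesh n)"
      using path_approx(1)[OF \<omega>, of n] T by linarith
    also have "?a / 2 * disp (D n \<omega>) - x = ?a / 2 * (disp (D n \<omega>) - 2 * x / ?a)"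
      using alg[OF a] by simp
    also have "\<bar>\<dots>\<bar> = ?a / 2 * \<bar>disp (D n \<omega>) - 2 * x / ?a\<bar>"
      using alg'[OF a] .
    also have "2 * (c * real (2 * K + 1) * mesh n) = ?a / 2 * real (4 * (2 * K + 1))"
      by (simp add: algebra_simps)
    finally show "\<bar>disp (D n \<omega>) - 2 * x / ?a\<bar> \<le> real (4 * (2 * K + 1))"
      using a by (subst (asm) mult_le_cancel_left_pos) auto
  qed
  then have "prob {\<omega>\<in>E. \<bar>T \<omega> - x\<bar> \<le> c * real (2 * K + 1) * mesh n}
      \<le> prob {\<omega>\<in>E. \<bar>disp (D n \<omega>) - 2 * x / (c * mesh n)\<bar> \<le> real (4 * (2 * K + 1))}"
    by (intro finite_measure_mono sets_D)
  also have "\<dots> \<le> (K + 1) * (4 * (2 * K + 1) + 1) / Suc n"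
    by (rule window_D)
  finally show ?thesis .
qed

text \<open>An atom at \<open>x\<close> would lie in every window around \<open>x\<close>, and the
  window probabilities are of order \<open>1 / Suc n\<close>.\<close>

lemma prob_T_eq: "prob {\<omega>\<in>E. T \<omega> = x} = 0"
proof -
  have "prob {\<omega>\<in>E. T \<omega> = x} \<le> (K + 1) * (4 * (2 * K + 1) + 1) / Suc n" for n
  proof -
    have "0 \<le> c * real (2 * K + 1) * mesh n" using speed_pos mesh_pos[of n] by simp
    then have "{\<omega>\<in>E. T \<omega> = x} \<subseteq> {\<omega>\<in>E. T \<omega> \<in> {y. \<bar>y - x\<bar> \<le> c * real (2 * K + 1) * mesh n}}" by auto
    moreover have "{y :: real. \<bar>y - x\<bar> \<le> c * real (2 * K + 1) * mesh n} \<in> sets borel" by measurable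
    ultimately have "prob {\<omega>\<in>E. T \<omega> = x} \<le> prob {\<omega>\<in>E. T \<omega> \<in> {y. \<bar>y - x\<bar> \<le> c * real (2 * K + 1) * mesh n}}"
      by (intro finite_measure_mono sets_T)
    then show ?thesis using window_T[of x n] by simp
  qed
  moreover have "(\<lambda>n. (K + 1) * (4 * (2 * K + 1) + 1) / Suc n) \<longlonglongrightarrow> 0"
    by (rule LIMSEQ_Suc[OF lim_const_over_n])
  ultimately have "prob {\<omega>\<in>E. T \<omega> = x} \<le> 0"
    by (intro LIMSEQ_le_const[where X = "\<lambda>n. (K + 1) * (4 * (2 * K + 1) + 1) / Suc n"]) auto
  then show ?thesis by (simp add: measure_le_0_iff)
qed

text \<open>Split by the endpoint. Hitting and ending below \<open>B\<close> is as likely as ending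
  above it, by reflection; ending at or above \<open>B\<close> implies a hit.\<close>

lemma prob_hits:
  assumes "even B" "B > 0"
  shows "prob {\<omega>\<in>E. hits B (D n \<omega>)} = prob {\<omega>\<in>E. B < disp (D n \<omega>)} + prob {\<omega>\<in>E. B \<le> disp (D n \<omega>)}"
proof -
  have "hits B d" if "B \<le> disp d" for d
    using that unfolding hits_def by (intro exI[of _ "length d"]) auto
  then have eq: "{\<omega>\<in>E. hits B (D n \<omega>)} = {\<omega>\<in>E. hits B (D n \<omega>) \<and> disp (D n \<omega>) < B} \<union> {\<omega>\<in>E. B \<le> disp (D n \<omega>)}"
    by auto
  have disj: "{\<omega>\<in>E. hits B (D n \<omega>) \<and> disp (D n \<omega>) < B} \<inter> {\<omega>\<in>E. B \<le> disp (D n \<omega>)} = {}"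
    by (rule equals0I) (elim IntE CollectE conjE, linarith)
  have "{\<omega>\<in>E. hits B (D n \<omega>) \<and> disp (D n \<omega>) < B} \<in> sets M" "{\<omega>\<in>E. B \<le> disp (D n \<omega>)} \<in> sets M"
    by (rule sets_D)+
  from finite_measure_Union[OF this disj] show ?thesis
    unfolding eq[symmetric] prob_hits_below_eq_D[OF assms] .
qed

text \<open>The margin with \<open>4 * K + 3\<close> is two approximation errors \<open>?L\<close>
  plus one rounding \<open>?a\<close> of the level to the grid; the same margin serves the lower
  bound.\<close>

lemma prob_S_upper:
  assumes "\<beta> > 0"
  shows "prob {\<omega>\<in>E. S \<omega> > \<beta> + c * real (4 * K + 3) * mesh n}
    \<le> 2 * (prob {\<omega>\<in>E. T \<omega> > \<beta>} + (K + 1) * (4 * (2 * K + 1) + 1) / Suc n)"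
proof -
  let ?a = "c * mesh n" and ?L = "c * real (2 * K + 1) * mesh n"
  \<comment> \<open>The even level \<open>2 * m\<close> stands for the height \<open>?a * m\<close>,
    the least integer multiple of \<open>?a\<close> that is at least \<beta>.\<close>
  define m where "m = \<lceil>\<beta> / ?a\<rceil>"
  have a: "?a > 0" using speed_pos mesh_pos by simp
  have L: "c * real (4 * K + 3) * mesh n = 2 * ?L + ?a" by (simp add: algebra_simps)
  have "m > 0" using assms a by (simp add: m_def)
  have "\<beta> / ?a \<le> m" "m < \<beta> / ?a + 1" unfolding m_def by linarith+
  moreover have "b \<le> y * z \<and> y * z < b + y" if "y > 0" "b / y \<le> z" "z < b / y + 1" for b y z :: real
    using that by (simp add: field_simps)
  ultimately have m: "\<beta> \<le> ?a * m" "?a * m < \<beta> + ?a" using a by blast+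
  have half: "?a / 2 * real_of_int (2 * m) = ?a * m" by simp
  have cmp: "?a / 2 * real_of_int i \<le> ?a / 2 * real_of_int j \<longleftrightarrow> i \<le> j" for i j
    using a by (simp only: mult_le_cancel_left_pos half_gt_zero of_int_le_iff)
  have le: "prob {\<omega>\<in>E. 2 * m < disp (D n \<omega>)} \<le> prob {\<omega>\<in>E. 2 * m \<le> disp (D n \<omega>)}"
    by (intro finite_measure_mono sets_D) auto
  have "{\<omega>\<in>E. S \<omega> > \<beta> + c * real (4 * K + 3) * mesh n} \<subseteq> {\<omega>\<in>E. hits (2 * m) (D n \<omega>)}"
  proof safe
    fix \<omega> assume \<omega>: "\<omega> \<in> E" and S: "S \<omega> > \<beta> + c * real (4 * K + 3) * mesh n"
    have "0 \<le> ?L" using speed_pos mesh_pos[of n] by simp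
    with path_approx(2)[OF \<omega>, of n] S m have "?a / 2 * real_of_int (2 * m) \<le> ?a / 2 * max_disp (D n \<omega>)"
      unfolding L half by linarith
    then show "hits (2 * m) (D n \<omega>)" by (simp only: cmp max_disp_ge_iff)
  qed
  then have "prob {\<omega>\<in>E. S \<omega> > \<beta> + c * real (4 * K + 3) * mesh n} \<le> prob {\<omega>\<in>E. hits (2 * m) (D n \<omega>)}"
    by (intro finite_measure_mono sets_D)
  also have "\<dots> = prob {\<omega>\<in>E. 2 * m < disp (D n \<omega>)} + prob {\<omega>\<in>E. 2 * m \<le> disp (D n \<omega>)}"
    using \<open>m > 0\<close> by (intro prob_hits) auto
  also have "\<dots> \<le> 2 * prob {\<omega>\<in>E. 2 * m \<le> disp (D n \<omega>)}"
    using le by simp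
  \<comment> \<open>Ending at or above the level only gives \<open>T\<close> at least \<beta> minus
    \<open>?L\<close>. The part not above \<beta> lies in a window of small probability.\<close>
  also have "prob {\<omega>\<in>E. 2 * m \<le> disp (D n \<omega>)} \<le> prob ({\<omega>\<in>E. T \<omega> \<in> {\<beta><..}} \<union> {\<omega>\<in>E. T \<omega> \<in> {y. \<bar>y - \<beta>\<bar> \<le> ?L}})"
  proof (rule finite_measure_mono)
    show "{\<omega>\<in>E. 2 * m \<le> disp (D n \<omega>)} \<subseteq> {\<omega>\<in>E. T \<omega> \<in> {\<beta><..}} \<union> {\<omega>\<in>E. T \<omega> \<in> {y. \<bar>y - \<beta>\<bar> \<le> ?L}}"
    proof
      fix \<omega> assume \<omega>: "\<omega> \<in> {\<omega>\<in>E. 2 * m \<le> disp (D n \<omega>)}"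
      then have "?a / 2 * real_of_int (2 * m) \<le> ?a / 2 * disp (D n \<omega>)" unfolding cmp by simp
      with path_approx(1)[of \<omega> n] \<omega> m have "\<beta> - ?L \<le> T \<omega>" unfolding half by simp
      with \<omega> show "\<omega> \<in> {\<omega>\<in>E. T \<omega> \<in> {\<beta><..}} \<union> {\<omega>\<in>E. T \<omega> \<in> {y. \<bar>y - \<beta>\<bar> \<le> ?L}}"
        by (cases "T \<omega> > \<beta>") auto
    qed
    have "{y :: real. \<bar>y - \<beta>\<bar> \<le> ?L} \<in> sets borel" by measurable
    then show "{\<omega>\<in>E. T \<omega> \<in> {\<beta><..}} \<union> {\<omega>\<in>E. T \<omega> \<in> {y. \<bar>y - \<beta>\<bar> \<le> ?L}} \<in> sets M"
      by (intro sets.Un sets_T) auto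
  qed
  also have "\<dots> \<le> prob {\<omega>\<in>E. T \<omega> \<in> {\<beta><..}} + prob {\<omega>\<in>E. T \<omega> \<in> {y. \<bar>y - \<beta>\<bar> \<le> ?L}}"
    by (intro measure_Un_le sets_T) measurable
  also have "prob {\<omega>\<in>E. T \<omega> \<in> {y. \<bar>y - \<beta>\<bar> \<le> ?L}} \<le> (K + 1) * (4 * (2 * K + 1) + 1) / Suc n"
    using window_T[of \<beta> n] by simp
  finally show ?thesis by simp
qed

lemma prob_S_lower:
  assumes "\<beta> > 0"
  shows "2 * prob {\<omega>\<in>E. T \<omega> > \<beta> + c * real (4 * K + 3) * mesh n} \<le> prob {\<omega>\<in>E. S \<omega> > \<beta>}"
proof -
  let ?a = "c * mesh n" and ?L = "c * real (2 * K + 1) * mesh n"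
  \<comment> \<open>The height \<open>?a * m\<close> is the least multiple of \<open>?a\<close>
    strictly above \<beta> plus the error \<open>?L\<close>, so a discrete hit forces
    \<open>S\<close> above \<beta>.\<close>
  define m where "m = \<lfloor>(\<beta> + ?L) / ?a\<rfloor> + 1"
  have a: "?a > 0" using speed_pos mesh_pos by simp
  have L0: "0 \<le> ?L" using speed_pos mesh_pos[of n] by simp
  have L: "c * real (4 * K + 3) * mesh n = 2 * ?L + ?a" by (simp add: algebra_simps)
  have "(\<beta> + ?L) / ?a < m" "m \<le> (\<beta> + ?L) / ?a + 1" unfolding m_def by linarith+
  moreover have "b < y * z \<and> y * z \<le> b + y" if "y > 0" "b / y < z" "z \<le> b / y + 1" for b y z :: real
    using that by (simp add: field_simps)
  ultimately have m: "\<beta> + ?L < ?a * m" "?a * m \<le> \<beta> + ?L + ?a" using a by blast+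
  have "0 < ?a * m" using m(1) assms L0 by linarith
  then have "m > 0" using a by (simp add: zero_less_mult_iff)
  have half: "?a / 2 * real_of_int (2 * m) = ?a * m" by simp
  have cmp: "?a / 2 * real_of_int i \<le> ?a / 2 * real_of_int j \<longleftrightarrow> i \<le> j" for i j
    using a by (simp only: mult_le_cancel_left_pos half_gt_zero of_int_le_iff)
  have "{\<omega>\<in>E. T \<omega> > \<beta> + c * real (4 * K + 3) * mesh n} \<subseteq> {\<omega>\<in>E. 2 * m < disp (D n \<omega>)}"
  proof safe
    fix \<omega> assume \<omega>: "\<omega> \<in> E" and T: "T \<omega> > \<beta> + c * real (4 * K + 3) * mesh n"
    with path_approx(1)[OF \<omega>, of n] m have "\<not> ?a / 2 * disp (D n \<omega>) \<le> ?a / 2 * real_of_int (2 * m)"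
      unfolding L half by linarith
    then show "2 * m < disp (D n \<omega>)" unfolding cmp by simp
  qed
  then have 1: "prob {\<omega>\<in>E. T \<omega> > \<beta> + c * real (4 * K + 3) * mesh n} \<le> prob {\<omega>\<in>E. 2 * m < disp (D n \<omega>)}"
    by (intro finite_measure_mono sets_D)
  have 2: "prob {\<omega>\<in>E. 2 * m < disp (D n \<omega>)} \<le> prob {\<omega>\<in>E. 2 * m \<le> disp (D n \<omega>)}"
    by (intro finite_measure_mono sets_D) auto
  have "{\<omega>\<in>E. hits (2 * m) (D n \<omega>)} \<subseteq> {\<omega>\<in>E. S \<omega> \<in> {\<beta><..}}"
  proof safe
    fix \<omega> assume \<omega>: "\<omega> \<in> E" and "hits (2 * m) (D n \<omega>)"
    then have "?a / 2 * real_of_int (2 * m) \<le> ?a / 2 * max_disp (D n \<omega>)"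
      by (simp only: cmp max_disp_ge_iff)
    with path_approx(2)[OF \<omega>, of n] m have "\<beta> < S \<omega>"
      unfolding half by linarith
    then show "\<beta> < S \<omega>" .
  qed
  then have 3: "prob {\<omega>\<in>E. hits (2 * m) (D n \<omega>)} \<le> prob {\<omega>\<in>E. S \<omega> \<in> {\<beta><..}}"
    by (intro finite_measure_mono sets_S) auto
  have "prob {\<omega>\<in>E. hits (2 * m) (D n \<omega>)} = prob {\<omega>\<in>E. 2 * m < disp (D n \<omega>)} + prob {\<omega>\<in>E. 2 * m \<le> disp (D n \<omega>)}"
    using \<open>m > 0\<close> by (intro prob_hits) auto
  with 1 2 3 show ?thesis by simp
qed

text \<open>The margins in both bounds are a constant over \<open>Suc n\<close>, so they vanish in
  the limit together with the window term.\<close>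

lemma prob_S_eq:
  assumes "\<beta> > 0"
  shows "prob {\<omega>\<in>E. S \<omega> > \<beta>} = 2 * prob {\<omega>\<in>E. T \<omega> > \<beta>}"
proof (rule antisym)
  let ?C = "c * real (4 * K + 3) * t"
  have C: "?C \<ge> 0" and mesh: "c * real (4 * K + 3) * mesh n = ?C / Suc n" for n
    using speed_pos t by (simp_all add: mesh_def)
  have S: "{\<omega>\<in>E. S \<omega> > y} \<in> sets M" and T: "{\<omega>\<in>E. T \<omega> > y} \<in> sets M" for y
    using sets_S[of "{y<..}"] sets_T[of "{y<..}"] by auto
  have "(\<lambda>n. 2 * (prob {\<omega>\<in>E. T \<omega> > \<beta>} + (K + 1) * (4 * (2 * K + 1) + 1) / Suc n))
      \<longlonglongrightarrow> 2 * (prob {\<omega>\<in>E. T \<omega> > \<beta>} + 0)"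
    by (intro tendsto_mult_left tendsto_add tendsto_const LIMSEQ_Suc[OF lim_const_over_n])
  then have "(\<lambda>n. 2 * (prob {\<omega>\<in>E. T \<omega> > \<beta>} + (K + 1) * (4 * (2 * K + 1) + 1) / Suc n))
      \<longlonglongrightarrow> 2 * prob {\<omega>\<in>E. T \<omega> > \<beta>}" by simp
  then show "prob {\<omega>\<in>E. S \<omega> > \<beta>} \<le> 2 * prob {\<omega>\<in>E. T \<omega> > \<beta>}"
    using prob_S_upper[OF assms]
    by (intro LIMSEQ_le[OF measure_greater_tendsto[OF S C]]) (auto simp only: mesh)
  have "(\<lambda>n. 2 * prob {\<omega>\<in>E. T \<omega> > \<beta> + ?C / Suc n}) \<longlonglongrightarrow> 2 * prob {\<omega>\<in>E. T \<omega> > \<beta>}"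
    by (intro tendsto_mult_left measure_greater_tendsto[OF T C])
  then show "2 * prob {\<omega>\<in>E. T \<omega> > \<beta>} \<le> prob {\<omega>\<in>E. S \<omega> > \<beta>}"
    using prob_S_lower[OF assms] by (intro LIMSEQ_le_const2) (auto simp only: mesh)
qed

text \<open>As \<open>T\<close> never exceeds \<open>S\<close>, the event that \<open>S\<close>
  exceeds \<beta> splits by the position of \<open>T\<close>. The part with \<open>T\<close> equal
  to \<beta> is null and the part above accounts for half of the probability.\<close>

lemma prob_S_T_less:
  assumes "\<beta> > 0"
  shows "prob {\<omega>\<in>E. S \<omega> > \<beta> \<and> T \<omega> < \<beta>} = prob {\<omega>\<in>E. T \<omega> > \<beta>}"
proof -
  have S: "{\<omega>\<in>E. S \<omega> > \<beta>} \<in> sets M" and T: "{\<omega>\<in>E. T \<omega> > \<beta>} \<in> sets M"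
    and T': "{\<omega>\<in>E. T \<omega> < \<beta>} \<in> sets M" "{\<omega>\<in>E. T \<omega> = \<beta>} \<in> sets M"
    using sets_S[of "{\<beta><..}"] sets_T[of "{\<beta><..}"] sets_T[of "{..<\<beta>}"] sets_T[of "{\<beta>}"]
    by auto
  have "{\<omega>\<in>E. S \<omega> > \<beta>} \<inter> {\<omega>\<in>E. T \<omega> < \<beta>} \<in> sets M" "{\<omega>\<in>E. S \<omega> > \<beta>} \<inter> {\<omega>\<in>E. T \<omega> = \<beta>} \<in> sets M"
    using S T' by (simp_all only: sets.Int)
  then have ST: "{\<omega>\<in>E. S \<omega> > \<beta> \<and> T \<omega> < \<beta>} \<in> sets M" "{\<omega>\<in>E. S \<omega> > \<beta> \<and> T \<omega> = \<beta>} \<in> sets M"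
    by (simp_all add: Int_def conj_ac)
  let ?U = "{\<omega>\<in>E. S \<omega> > \<beta> \<and> T \<omega> < \<beta>}" and ?V = "{\<omega>\<in>E. T \<omega> > \<beta>}"
    and ?W = "{\<omega>\<in>E. S \<omega> > \<beta> \<and> T \<omega> = \<beta>}"
  have eq: "{\<omega>\<in>E. S \<omega> > \<beta>} = (?U \<union> ?V) \<union> ?W"
    using path_approx(3) by force
  have disj: "?U \<inter> ?V = {}" "(?U \<union> ?V) \<inter> ?W = {}"
    by (rule equals0I; elim IntE UnE CollectE conjE; linarith)+
  have "prob {\<omega>\<in>E. S \<omega> > \<beta>} = prob ?U + prob ?V + prob ?W"
    unfolding eq finite_measure_Union[OF sets.Un[OF ST(1) T] ST(2) disj(2)]
      finite_measure_Union[OF ST(1) T disj(1)] ..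
  moreover have "prob ?W \<le> prob {\<omega>\<in>E. T \<omega> = \<beta>}"
    using T' by (intro finite_measure_mono) auto
  ultimately show ?thesis
    using prob_S_eq[OF assms] prob_T_eq[of \<beta>] measure_nonneg[of M ?W] by linarith
qed

end

theorem mainTheorem3:
  fixes M :: "'a measure" and N :: "real \<Rightarrow> 'a \<Rightarrow> nat" and V0 :: "'a \<Rightarrow> real"
    and rate c t \<beta> :: real and k :: nat
  assumes "symmetric_telegraph M N rate V0 c"
    and "t > 0" and "0 < \<beta>" and "\<beta> < c * t"
  shows "\<P>(\<omega> in M. running_max (telegraph V0 N) t \<omega> > \<beta> \<and> telegraph V0 N t \<omega> < \<beta>
             \<bar> N t \<omega> = 2 * k + 1 \<and> V0 \<omega> = c)
       = \<P>(\<omega> in M. running_max (telegraph V0 N) t \<omega> > \<beta> \<and> telegraph V0 N t \<omega> > \<beta>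
             \<bar> N t \<omega> = 2 * k + 1 \<and> V0 \<omega> = c)
     \<and> \<P>(\<omega> in M. running_max (telegraph V0 N) t \<omega> > \<beta> \<and> telegraph V0 N t \<omega> > \<beta>
             \<bar> N t \<omega> = 2 * k + 1 \<and> V0 \<omega> = c)
       = \<P>(\<omega> in M. telegraph V0 N t \<omega> > \<beta> \<bar> N t \<omega> = 2 * k + 1 \<and> V0 \<omega> = c)"
proof -
  interpret symmetric_telegraph M N rate V0 c by fact
  interpret telegraph_odd M N rate V0 c t "2 * k + 1"
    by unfold_locales (use assms in auto)
  \<comment> \<open>All the conditional probabilities have the same denominator, so only numerators,
    which are events within \<open>E\<close>, must be compared.\<close>
  have joint: "{\<omega>\<in>space M. P \<omega> \<and> N t \<omega> = 2 * k + 1 \<and> V0 \<omega> = c} = {\<omega>\<in>E. P \<omega>}" for P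
    unfolding E_def by auto
  have "{\<omega>\<in>E. S \<omega> > \<beta> \<and> T \<omega> > \<beta>} = {\<omega>\<in>E. T \<omega> > \<beta>}"
    using path_approx(3) by force
  then show ?thesis
    unfolding cond_prob_def joint using prob_S_T_less[OF \<open>0 < \<beta>\<close>] by simp
qed

end
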